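(* Let $c(n)>0$ and $d(n)\ge 1$ (an integer) be functions of $n$ with $c(n)d(n)=o(\log n)$, and let $\epsilon>0$ be any constant. Then for all sufficiently large $n$ (with $c(n)n$ an integer), with probability at least $1-1/n$, the most full bin after all balls have been placed by $\mathrm{GREEDY}(c(n)n,n,d(n))$ has load less than $$\frac{(2+\epsilon)\log n}{\log(2+\epsilon)+\log\log n-\log c(n)-\log d(n)}.$$
   Context: $\mathrm{GREEDY}(m,n,d)$ places $m$ balls into $n$ bins $B_1,\dots,B_n$ over time steps $t=1,\dots,m$. At each time step, $d$ indices are selected from $[n]=\{1,\dots,n\}$ independently and uniformly at random with replacement, forming a multiset $S_t$; the $t$-th ball is placed into a bin $B_M$ with $M\in S_t$ whose current load is maximal among the bins indexed by $S_t$; ties among maximal bins are broken uniformly at random. The load of a bin is the number of balls in it. $\log$ denotes the natural logarithm. *)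

theory Defs
  imports "HOL-Probability.Probability" "HOL-Library.Landau_Symbols" "HOL-Library.Multiset"
begin

text \<open>A state assigns to each bin index its load; bins are indexed by \<open>{1..n}\<close>.\<close>

definition choices :: "nat \<Rightarrow> nat \<Rightarrow> nat multiset pmf" where
  "choices n d = map_pmf mset (replicate_pmf d (pmf_of_set {1..n}))"

text \<open>A tie is broken uniformly among the distinct maximal bins: the multiplicity with which a bin
  was selected does not matter.\<close>

definition fullest :: "(nat \<Rightarrow> nat) \<Rightarrow> nat multiset \<Rightarrow> nat set" where
  "fullest L S = {M. M \<in># S \<and> (\<forall>j\<in>#S. L j \<le> L M)}"

definition greedy_step :: "nat \<Rightarrow> nat \<Rightarrow> (nat \<Rightarrow> nat) \<Rightarrow> (nat \<Rightarrow> nat) pmf" where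
  "greedy_step n d L =
     bind_pmf (choices n d) (\<lambda>S.
     bind_pmf (pmf_of_set (fullest L S)) (\<lambda>M.
     return_pmf (L(M := L M + 1))))"

primrec greedy :: "nat \<Rightarrow> nat \<Rightarrow> nat \<Rightarrow> (nat \<Rightarrow> nat) pmf" where
  "greedy 0 n d = return_pmf (\<lambda>_. 0)"
| "greedy (Suc m) n d = bind_pmf (greedy m n d) (greedy_step n d)"

definition max_load :: "nat \<Rightarrow> (nat \<Rightarrow> nat) \<Rightarrow> nat" where
  "max_load n L = Max (L ` {1..n})"

end

theory Submission
  imports Defs "HOL-Real_Asymp.Real_Asymp"
begin

text \<open>
  A ball lands in a fixed bin only if that bin is among the \<open>d\<close> selected ones, which has probability
  at most \<open>d / n\<close> whatever the history. Hence the moment generating function of the load of a bin is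
  bounded by \<open>exp (\<mu> * (s - 1))\<close> with \<open>\<mu> = c d\<close>, as for a Poisson variable. With
  \<open>A = (2 + \<epsilon>) ln n\<close> and \<open>D = ln (A / \<mu>)\<close>, the threshold is \<open>A / D\<close> and Markov's inequality at
  \<open>s = A / (D \<mu>)\<close> bounds the tail by \<open>exp (- A (1 - (1 + ln D) / D))\<close>. As \<open>D\<close> tends to infinity,
  this is eventually at most \<open>1 / n\<^sup>2\<close>, and a union bound over the bins concludes.
\<close>

text \<open>Union bound over the \<open>d\<close> draws, carried out by induction on the list of
  draws: either the head is \<open>i\<close> or \<open>i\<close> occurs in the tail.\<close>

lemma prob_mem_choices_le:
  assumes "n \<ge> 1"
  shows "emeasure (measure_pmf (choices n d)) {S. i \<in># S} \<le> ennreal (real d / real n)"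
proof -
  let ?U = "pmf_of_set {1..n}"
  let ?R = "\<lambda>d. replicate_pmf d ?U"
  \<comment> \<open>Only an inequality: the mass is 0 when \<open>i\<close> lies outside
    \<open>{1..n}\<close>.\<close>
  have U: "emeasure (measure_pmf ?U) {i} \<le> ennreal (1 / real n)"
    using assms by (auto simp: emeasure_pmf_single indicator_def intro!: ennreal_leI)
  have "emeasure (measure_pmf (?R d)) {xs. i \<in> set xs} \<le> ennreal (real d / real n)"
  proof (induction d)
    case 0
    show ?case by simp
  next
    case (Suc d)
    have "emeasure (measure_pmf (?R (Suc d))) {xs. i \<in> set xs}
        = (\<integral>\<^sup>+xs. indicator {xs. i \<in> set xs} xs \<partial>?R (Suc d))"
      by (rule nn_integral_indicator[symmetric]) simp
    also have "\<dots> = (\<integral>\<^sup>+x. \<integral>\<^sup>+xs. indicator {xs. i \<in> set xs} (x # xs) \<partial>?R d \<partial>?U)"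
      by (simp del: nn_integral_indicator)
    also have "\<dots> \<le> (\<integral>\<^sup>+x. \<integral>\<^sup>+xs. indicator {i} x + indicator {xs. i \<in> set xs} xs \<partial>?R d \<partial>?U)"
      by (intro nn_integral_mono) (auto simp: indicator_def)
    also have "\<dots> = emeasure (measure_pmf ?U) {i} + emeasure (measure_pmf (?R d)) {xs. i \<in> set xs}"
      by (simp add: nn_integral_add)
    also have "\<dots> \<le> ennreal (1 / real n) + ennreal (real d / real n)"
      by (intro add_mono U Suc)
    also have "\<dots> = ennreal (real (Suc d) / real n)"
      by (simp add: ennreal_plus[symmetric] add_divide_distrib del: ennreal_plus)
    finally show ?case .
  qed
  then show ?thesis
    by (simp add: choices_def vimage_def)
qed

lemma fullest_finite: "finite (fullest L S)"
  by (rule finite_subset[of _ "set_mset S"]) (auto simp: fullest_def)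

lemma fullest_nonempty:
  assumes "S \<noteq> {#}"
  shows "fullest L S \<noteq> {}"
proof -
  have "Max (L ` set_mset S) \<in> L ` set_mset S"
    using assms by (intro Max_in) auto
  then obtain M where M: "M \<in># S" "L M = Max (L ` set_mset S)"
    by auto
  have "M \<in> fullest L S"
    using M by (auto simp: fullest_def)
  then show ?thesis by blast
qed

text \<open>One ball multiplies \<open>s ^ L i\<close> by \<open>s\<close> or by 1, and by
  \<open>s\<close> only if \<open>i\<close> was selected. The rule for choosing among the selected
  bins does not enter, so the factor is the same for every state \<open>L\<close>.\<close>

lemma nn_integral_greedy_step_le:
  assumes n: "n \<ge> 1" and d: "d \<ge> 1" and s: "s \<ge> 1"
  shows "(\<integral>\<^sup>+L'. ennreal (s ^ L' i) \<partial>greedy_step n d L)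
      \<le> ennreal (1 + (s - 1) * (real d / real n)) * ennreal (s ^ L i)"
proof -
  have "(\<integral>\<^sup>+L'. ennreal (s ^ L' i) \<partial>greedy_step n d L) =
     (\<integral>\<^sup>+S. \<integral>\<^sup>+M. ennreal (s ^ (L(M := L M + 1)) i) \<partial>pmf_of_set (fullest L S) \<partial>choices n d)"
    unfolding greedy_step_def by simp
  also have "\<dots> \<le> (\<integral>\<^sup>+S. ennreal (s ^ L i) *
                  (1 + ennreal (s - 1) * indicator {S. i \<in># S} S) \<partial>choices n d)"
  proof (intro nn_integral_mono_AE AE_pmfI)
    fix S assume "S \<in> set_pmf (choices n d)"
    then have "S \<noteq> {#}"
      using d by (auto simp: choices_def set_replicate_pmf)
    \<comment> \<open>\<open>pmf_of_set\<close> has its intended support only on a nonempty finite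
      set; nonemptiness comes from \<open>d \<ge> 1\<close>.\<close>
    then have set_pmf: "set_pmf (pmf_of_set (fullest L S)) = fullest L S"
      by (intro set_pmf_of_set fullest_finite fullest_nonempty)
    let ?r = "ennreal (s ^ L i) * (1 + ennreal (s - 1) * indicator {S. i \<in># S} S)"
    have "(\<integral>\<^sup>+M. ennreal (s ^ (L(M := L M + 1)) i) \<partial>pmf_of_set (fullest L S))
        \<le> (\<integral>\<^sup>+M. ?r \<partial>pmf_of_set (fullest L S))"
    proof (intro nn_integral_mono_AE AE_pmfI)
      fix M assume "M \<in> set_pmf (pmf_of_set (fullest L S))"
      then have "M \<in># S" by (simp add: set_pmf) (simp add: fullest_def)
      \<comment> \<open>If bin \<open>i\<close> receives the ball, then \<open>i\<close> is selected
        and the factor is exactly \<open>1 + (s - 1) = s\<close>; otherwise the load of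
        \<open>i\<close> is unchanged and a factor of at least 1 suffices.\<close>
      then have "M = i \<Longrightarrow> ?r = ennreal (s ^ (L i + 1))"
        using s by (simp add: ennreal_mult[symmetric] ennreal_1[symmetric] ennreal_plus[symmetric]
            mult.commute del: ennreal_1 ennreal_plus)
      moreover have "ennreal (s ^ L i) * 1 \<le> ?r"
        by (intro mult_left_mono) auto
      ultimately show "ennreal (s ^ (L(M := L M + 1)) i) \<le> ?r"
        by (cases "M = i") auto
    qed
    then show "(\<integral>\<^sup>+M. ennreal (s ^ (L(M := L M + 1)) i) \<partial>pmf_of_set (fullest L S)) \<le> ?r"
      by simp
  qed
  also have "\<dots> = ennreal (s ^ L i) *
      (1 + ennreal (s - 1) * emeasure (measure_pmf (choices n d)) {S. i \<in># S})"
    by (simp add: nn_integral_cmult nn_integral_add)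
  also have "\<dots> \<le> ennreal (s ^ L i) * (1 + ennreal (s - 1) * ennreal (real d / real n))"
    by (intro mult_left_mono add_left_mono prob_mem_choices_le n) auto
  also have "\<dots> = ennreal (1 + (s - 1) * (real d / real n)) * ennreal (s ^ L i)"
    using s by (simp add: ennreal_mult[symmetric] mult.commute)
  finally show ?thesis .
qed

lemma nn_integral_greedy_le:
  assumes "n \<ge> 1" and "d \<ge> 1" and s: "s \<ge> 1"
  shows "(\<integral>\<^sup>+L. ennreal (s ^ L i) \<partial>greedy m n d)
      \<le> ennreal ((1 + (s - 1) * (real d / real n)) ^ m)"
proof (induction m)
  case 0
  show ?case by simp
next
  case (Suc m)
  let ?q = "1 + (s - 1) * (real d / real n)"
  have q: "?q \<ge> 0" using s by simp
  have "(\<integral>\<^sup>+L. ennreal (s ^ L i) \<partial>greedy (Suc m) n d)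
      = (\<integral>\<^sup>+L. \<integral>\<^sup>+L'. ennreal (s ^ L' i) \<partial>greedy_step n d L \<partial>greedy m n d)"
    by simp
  \<comment> \<open>The factor does not depend on \<open>L\<close>, so it can be pulled out although
    successive placements are dependent.\<close>
  also have "\<dots> \<le> (\<integral>\<^sup>+L. ennreal ?q * ennreal (s ^ L i) \<partial>greedy m n d)"
    by (intro nn_integral_mono nn_integral_greedy_step_le assms)
  also have "\<dots> = ennreal ?q * (\<integral>\<^sup>+L. ennreal (s ^ L i) \<partial>greedy m n d)"
    by (simp add: nn_integral_cmult)
  also have "\<dots> \<le> ennreal ?q * ennreal (?q ^ m)"
    by (intro mult_left_mono Suc) auto
  also have "\<dots> = ennreal (?q ^ Suc m)"
    using q by (simp add: ennreal_mult del: ennreal_plus)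
  finally show ?case .
qed

text \<open>Exponential Markov inequality: on the event, \<open>s powr (real (L i) - x)\<close> is
  at least 1. The real exponent is needed because the threshold \<open>x\<close> is not an integer
  in general.\<close>

lemma prob_load_ge_le:
  assumes "n \<ge> 1" and "d \<ge> 1" and s: "s \<ge> 1"
  shows "measure_pmf.prob (greedy m n d) {L. real (L i) \<ge> x}
      \<le> exp (real m * real d / real n * (s - 1)) * s powr (- x)"
proof -
  let ?P = "measure_pmf (greedy m n d)"
  let ?q = "(s - 1) * (real d / real n)"
  have q: "?q \<ge> 0" using s by simp
  have "emeasure ?P {L. real (L i) \<ge> x} = (\<integral>\<^sup>+L. indicator {L. real (L i) \<ge> x} L \<partial>?P)"
    by simp
  also have "\<dots> \<le> (\<integral>\<^sup>+L. ennreal (s powr (- x)) * ennreal (s ^ L i) \<partial>?P)"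
  proof (intro nn_integral_mono)
    fix L :: "nat \<Rightarrow> nat"
    have "s powr (- x) * s ^ L i = s powr (real (L i) - x)"
      using s by (simp add: powr_realpow[symmetric] powr_add[symmetric])
    moreover have "1 \<le> s powr (real (L i) - x)" if "real (L i) \<ge> x"
      using s that by (intro ge_one_powr_ge_zero) auto
    ultimately show "indicator {L. real (L i) \<ge> x} L \<le> ennreal (s powr (- x)) * ennreal (s ^ L i)"
      using s by (auto simp: indicator_def ennreal_mult[symmetric])
  qed
  also have "\<dots> = ennreal (s powr (- x)) * (\<integral>\<^sup>+L. ennreal (s ^ L i) \<partial>?P)"
    by (simp add: nn_integral_cmult)
  also have "\<dots> \<le> ennreal (s powr (- x)) * ennreal ((1 + ?q) ^ m)"
    by (intro mult_left_mono nn_integral_greedy_le assms) auto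
  \<comment> \<open>\<open>1 + q \<le> exp q\<close> passes from the binomial to the Poisson
    generating function, which depends on \<open>m\<close>, \<open>n\<close>, \<open>d\<close> only
    through the mean \<open>m * d / n\<close>.\<close>
  also have "\<dots> \<le> ennreal (s powr (- x)) * ennreal (exp ?q ^ m)"
    using q by (intro mult_left_mono ennreal_leI power_mono exp_ge_add_one_self) auto
  also have "exp ?q ^ m = exp (real m * real d / real n * (s - 1))"
    by (simp add: exp_of_nat_mult[symmetric] algebra_simps)
  finally show ?thesis
    by (simp add: measure_pmf.emeasure_eq_measure ennreal_mult[symmetric] mult.commute)
qed

lemma prob_max_load_ge_le:
  assumes n: "n \<ge> 1" and "d \<ge> 1" and "s \<ge> 1"
  shows "measure_pmf.prob (greedy m n d) {L. real (max_load n L) \<ge> x}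
      \<le> real n * (exp (real m * real d / real n * (s - 1)) * s powr (- x))"
proof -
  let ?P = "measure_pmf (greedy m n d)"
  have max_load: "\<exists>i\<in>{1..n}. max_load n L = L i" for L
  proof -
    have "Max (L ` {1..n}) \<in> L ` {1..n}"
      using n by (intro Max_in) auto
    then show ?thesis
      by (simp only: max_load_def image_iff)
  qed
  have "{L. real (max_load n L) \<ge> x} \<subseteq> (\<Union>i\<in>{1..n}. {L. real (L i) \<ge> x})"
  proof
    fix L assume "L \<in> {L. real (max_load n L) \<ge> x}"
    with max_load[of L] show "L \<in> (\<Union>i\<in>{1..n}. {L. real (L i) \<ge> x})"
      by auto
  qed
  then have "measure ?P {L. real (max_load n L) \<ge> x} \<le> measure ?P (\<Union>i\<in>{1..n}. {L. real (L i) \<ge> x})"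
    by (intro measure_pmf.finite_measure_mono) auto
  also have "\<dots> \<le> (\<Sum>i\<in>{1..n}. measure ?P {L. real (L i) \<ge> x})"
    by (intro measure_pmf.finite_measure_subadditive_finite) auto
  also have "\<dots> \<le> (\<Sum>i\<in>{1..n}. exp (real m * real d / real n * (s - 1)) * s powr (- x))"
    by (intro sum_mono prob_load_ge_le assms)
  finally show ?thesis by simp
qed

text \<open>For the threshold \<open>x = A / D\<close>, the value \<open>s = x / \<mu>\<close>
  minimises \<open>exp (\<mu> * (s - 1)) * s powr (- x)\<close>. Taking
  \<open>D = ln (A / \<mu>)\<close> makes \<open>ln s\<close> equal to
  \<open>D - ln D\<close>.\<close>

lemma poisson_tail_exponent:
  fixes A \<mu> D :: real
  assumes A: "A > 0" and \<mu>: "\<mu> > 0" and D: "D = ln (A / \<mu>)" and D1: "D \<ge> 1"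
  defines "s \<equiv> A / (D * \<mu>)"
  shows "s \<ge> 1" and "exp (\<mu> * (s - 1)) * s powr (- (A / D)) \<le> exp (- (A * (1 - (1 + ln D) / D)))"
proof -
  have s0: "s > 0" using A \<mu> D1 by (simp add: s_def)
  have "s = (A / \<mu>) / D" by (simp add: s_def)
  then have lns: "ln s = D - ln D" using A \<mu> D1 ln_div[of "A / \<mu>" D] by (simp add: D[symmetric])
  have "ln D \<le> D - 1" using D1 by (intro ln_le_minus_one) auto
  then have "ln s \<ge> 0" using lns by simp
  then show "s \<ge> 1" using s0 by simp
  have "exp (\<mu> * (s - 1)) * s powr (- (A / D)) = exp (\<mu> * s - \<mu> - A / D * (D - ln D))"
    using s0 by (simp add: powr_def lns exp_add[symmetric] algebra_simps)
  \<comment> \<open>Since \<open>\<mu> * s = A / D\<close>, the two exponents differ only by the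
    term \<open>- \<mu>\<close>, which is dropped.\<close>
  also have "\<dots> \<le> exp (- (A * (1 - (1 + ln D) / D)))"
    using \<mu> D1 by (simp add: s_def field_simps)
  finally show "exp (\<mu> * (s - 1)) * s powr (- (A / D)) \<le> exp (- (A * (1 - (1 + ln D) / D)))" .
qed

theorem theorem3p4:
  fixes c :: "nat \<Rightarrow> real" and d :: "nat \<Rightarrow> nat" and \<epsilon> :: real
  assumes "\<And>n. n \<ge> 1 \<Longrightarrow> c n > 0"
    and "\<And>n. n \<ge> 1 \<Longrightarrow> d n \<ge> 1"
    and "(\<lambda>n. c n * real (d n)) \<in> o(\<lambda>n. ln (real n))"
    and "\<epsilon> > 0"
  shows "\<forall>\<^sub>F n in sequentially. \<forall>m::nat. real m = c n * real n \<longrightarrow>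
           measure_pmf.prob (greedy m n (d n))
             {L. real (max_load n L) <
                 (2 + \<epsilon>) * ln (real n) /
                 (ln (2 + \<epsilon>) + ln (ln (real n)) - ln (c n) - ln (real (d n)))}
           \<ge> 1 - 1 / real n"
proof -
  have "((\<lambda>D::real. (1 + ln D) / D) \<longlongrightarrow> 0) at_top"
    by real_asymp
  \<comment> \<open>The bound \<open>\<epsilon> / (2 + \<epsilon>)\<close> is the fraction of
    \<open>A\<close> that may be lost while \<open>2 * ln n\<close> remains in the exponent.\<close>
  then have "\<forall>\<^sub>F D::real in at_top. (1 + ln D) / D < \<epsilon> / (2 + \<epsilon>)"
    using assms(4) by (intro order_tendstoD) auto
  then have "\<forall>\<^sub>F D::real in at_top. D \<ge> 1 \<and> (1 + ln D) / D < \<epsilon> / (2 + \<epsilon>)"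
    by (intro eventually_conj eventually_ge_at_top)
  then obtain K where K: "D \<ge> 1" "(1 + ln D) / D < \<epsilon> / (2 + \<epsilon>)" if "D \<ge> K" for D :: real
    unfolding eventually_at_top_linorder by blast
  \<comment> \<open>The constant \<open>exp (- K)\<close> is chosen so that
    \<open>A / \<mu> \<ge> exp K\<close>, that is \<open>D \<ge> K\<close>, follows below.\<close>
  have "\<forall>\<^sub>F n in sequentially. norm (c n * real (d n)) \<le> exp (- K) * norm (ln (real n))"
    by (rule landau_o.smallD[OF assms(3)]) simp
  then show ?thesis
    using eventually_ge_at_top[of "2::nat"]
  proof eventually_elim
    case (elim n)
    have n1: "n \<ge> 1" and lnn: "ln (real n) > 0" using elim(2) by auto
    have cd: "c n > 0" "d n \<ge> 1" using assms(1,2) n1 by auto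
    define \<mu> where "\<mu> = c n * real (d n)"
    define A where "A = (2 + \<epsilon>) * ln (real n)"
    define D where "D = ln (A / \<mu>)"
    define x where "x = A / D"
    have \<mu>: "\<mu> > 0" and A: "A > 0"
      using cd lnn assms(4) by (auto simp: \<mu>_def A_def)
    \<comment> \<open>The denominator in the claim is \<open>D\<close>, so the claimed threshold is
      \<open>x\<close>.\<close>
    have D_eq: "ln (2 + \<epsilon>) + ln (ln (real n)) - ln (c n) - ln (real (d n)) = D"
      using cd lnn assms(4) \<mu> A unfolding D_def by (simp add: ln_div) (simp add: A_def \<mu>_def ln_mult)
    have "\<mu> \<le> exp (- K) * ln (real n)"
      using elim(1) \<mu> lnn by (simp add: \<mu>_def)
    also have "\<dots> \<le> exp (- K) * A"
      using lnn assms(4) by (auto simp: A_def algebra_simps)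
    finally have "exp K \<le> A / \<mu>"
      using \<mu> by (simp add: exp_minus field_simps)
    then have "K \<le> D"
      using \<mu> A by (simp add: D_def ln_ge_iff)
    note D1 = K[OF this]
    define s where "s = A / (D * \<mu>)"
    note tail = poisson_tail_exponent[OF A \<mu> D_def D1(1), folded s_def x_def]
    \<comment> \<open>An exponent of \<open>2 * ln n\<close> gives \<open>1 / n^2\<close> per bin,
      leaving \<open>1 / n\<close> after the union bound over \<open>n\<close> bins.\<close>
    have "2 * ln (real n) = A * (1 - \<epsilon> / (2 + \<epsilon>))"
      using assms(4) by (simp add: A_def field_simps)
    also have "\<dots> \<le> A * (1 - (1 + ln D) / D)"
      using D1(2) A by (intro mult_left_mono) auto
    finally have "exp (- (A * (1 - (1 + ln D) / D))) \<le> exp (- (2 * ln (real n)))"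
      by simp
    also have "\<dots> = 1 / real n ^ 2"
      using n1 by (simp add: exp_minus exp_double field_simps)
    finally have bound: "exp (\<mu> * (s - 1)) * s powr (- x) \<le> 1 / real n ^ 2"
      using tail(2) by linarith
    show ?case
    proof (intro allI impI)
      fix m :: nat
      assume m: "real m = c n * real n"
      let ?P = "measure_pmf (greedy m n (d n))"
      have \<mu>_eq: "real m * real (d n) / real n = \<mu>"
        using n1 by (simp add: m \<mu>_def)
      have "measure ?P {L. real (max_load n L) \<ge> x} \<le> real n * (exp (\<mu> * (s - 1)) * s powr (- x))"
        using prob_max_load_ge_le[OF n1 cd(2) tail(1), of m x] unfolding \<mu>_eq .
      also have "\<dots> \<le> real n * (1 / real n ^ 2)"
        by (intro mult_left_mono bound) auto
      also have "\<dots> = 1 / real n"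
        by (simp add: power2_eq_square)
      finally have "measure ?P {L. real (max_load n L) \<ge> x} \<le> 1 / real n" .
      moreover have "measure ?P {L. real (max_load n L) < x} = 1 - measure ?P {L. real (max_load n L) \<ge> x}"
        by (subst measure_pmf.prob_compl[symmetric]) (auto intro!: arg_cong[where f = "measure ?P"])
      ultimately show "measure ?P {L. real (max_load n L) <
          (2 + \<epsilon>) * ln (real n) / (ln (2 + \<epsilon>) + ln (ln (real n)) - ln (c n) - ln (real (d n)))}
        \<ge> 1 - 1 / real n"
        unfolding D_eq A_def[symmetric] x_def[symmetric] by linarith
    qed
  qed
qed

end
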